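(* Let $k\in\mathbb{N}$ and $\max\{|yt|,|zt|\}<1$. Then $$\sum_{n=0}^\infty\Psi_{n+k}^{(\mathbf a,\mathbf b)}(x,y,z|q)\,(-1)^{n+k}q^{\binom{n+k}{2}}\,\frac{t^n}{(q;q)_n} =\frac{(xt;q)_\infty}{t^k(yt;q)_\infty}\sum_{j=0}^k\frac{(q^{-k},yt;q)_j\,q^j}{(q,xt;q)_j}\;{}_r\Phi_s\left[\begin{matrix}a_1,\dots,a_r\\ b_1,\dots,b_s\end{matrix};q;ztq^j\right].$$
   Context: Throughout $q\in\mathbb{C}$ with $0<|q|<1$; the other letters denote complex numbers. $(a;q)_0=1$, $(a;q)_n=\prod_{i=0}^{n-1}(1-aq^i)$, $(a;q)_\infty=\prod_{i=0}^\infty(1-aq^i)$, and $(c_1,\dots,c_m;q)_n=(c_1;q)_n\cdots(c_m;q)_n$ (also for $n=\infty$). The $q$-binomial coefficient is $\begin{bmatrix}n\\k\end{bmatrix}_q=\frac{(q;q)_n}{(q;q)_k(q;q)_{n-k}}$. Let $r,s$ be non-negative integers, $\mathbf a=(a_1,\dots,a_r)$, $\mathbf b=(b_1,\dots,b_s)$, and $W_k(\mathbf a,\mathbf b)=\frac{(a_1,\dots,a_r;q)_k}{(b_1,\dots,b_s;q)_k}$. The basic hypergeometric series is $${}_r\Phi_s\left[\begin{matrix}a_1,\dots,a_r\\ b_1,\dots,b_s\end{matrix};q;z\right]=\sum_{k=0}^\infty W_k(\mathbf a,\mathbf b)\left[(-1)^kq^{\binom k2}\right]^{1+s-r}\frac{z^k}{(q;q)_k}.$$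 Cauchy polynomials: $P_n(x,y)=(x-y)(x-qy)\cdots(x-q^{n-1}y)$, $P_0=1$. Generalized $q$-hypergeometric polynomials: $$\Psi_n^{(\mathbf a,\mathbf b)}(x,y,z|q)=(-1)^nq^{-\binom n2}\sum_{k=0}^n\begin{bmatrix}n\\k\end{bmatrix}_q\left[(-1)^kq^{\binom k2}\right]^{1+s-r}W_k(\mathbf a,\mathbf b)\,P_{n-k}(y,x)\,z^k.$$ Parameters are understood to be such that no denominator vanishes and the ${}_r\Phi_s$ series occurring converge. *)

theory Defs
  imports "HOL-Analysis.Analysis"
begin

definition qpoch :: "complex \<Rightarrow> complex \<Rightarrow> nat \<Rightarrow> complex" where
  "qpoch a q n = (\<Prod>i<n. 1 - a * q ^ i)"

definition qpoch_inf :: "complex \<Rightarrow> complex \<Rightarrow> complex" where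
  "qpoch_inf a q = (\<Prod>i. 1 - a * q ^ i)"

definition qpochs :: "complex list \<Rightarrow> complex \<Rightarrow> nat \<Rightarrow> complex" where
  "qpochs cs q n = (\<Prod>c\<leftarrow>cs. qpoch c q n)"

definition qbinomial :: "complex \<Rightarrow> nat \<Rightarrow> nat \<Rightarrow> complex" where
  "qbinomial q n k = qpoch q q n / (qpoch q q k * qpoch q q (n - k))"

definition W :: "complex list \<Rightarrow> complex list \<Rightarrow> complex \<Rightarrow> nat \<Rightarrow> complex" where
  "W a b q k = qpochs a q k / qpochs b q k"

(* [(-1)^k q^(k choose 2)]^(1+s-r); the exponent 1+s-r may be negative, hence the integer power. *)
definition hyp_factor :: "nat \<Rightarrow> nat \<Rightarrow> complex \<Rightarrow> nat \<Rightarrow> complex" where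
  "hyp_factor r s q k = ((-1) ^ k * q ^ (k choose 2)) powi (1 + int s - int r)"

(* The numbers r and s of parameters are the lengths of the lists a and b. *)
definition Phi_term :: "complex list \<Rightarrow> complex list \<Rightarrow> complex \<Rightarrow> complex \<Rightarrow> nat \<Rightarrow> complex" where
  "Phi_term a b q z k =
     W a b q k * hyp_factor (length a) (length b) q k * (z ^ k / qpoch q q k)"

definition Phi :: "complex list \<Rightarrow> complex list \<Rightarrow> complex \<Rightarrow> complex \<Rightarrow> complex" where
  "Phi a b q z = (\<Sum>k. Phi_term a b q z k)"

definition cauchy_poly :: "complex \<Rightarrow> nat \<Rightarrow> complex \<Rightarrow> complex \<Rightarrow> complex" where
  "cauchy_poly q n x y = (\<Prod>i<n. x - q ^ i * y)"

definition Psi :: "complex list \<Rightarrow> complex list \<Rightarrow> complex \<Rightarrow> nat \<Rightarrow>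
    complex \<Rightarrow> complex \<Rightarrow> complex \<Rightarrow> complex" where
  "Psi a b q n x y z =
     (-1) ^ n * q powi (- int (n choose 2)) *
     (\<Sum>k\<le>n. qbinomial q n k * hyp_factor (length a) (length b) q k * W a b q k *
        cauchy_poly q (n - k) y x * z ^ k)"

end

theory Submission
  imports Defs
begin

text \<open>
  Let \<open>G\<^sub>n\<close> be \<open>\<Psi>\<^sub>n\<close> without its prefactor. The Cauchy product of the series \<open>\<Phi>\<close> with the
  \<open>q\<close>-binomial series yields \<open>F(t) = \<Sum> G\<^sub>n t\<^sup>n / (q;q)\<^sub>n = \<Phi>(zt) (xt;q)\<^sub>\<infinity> / (yt;q)\<^sub>\<infinity>\<close>.
  The \<open>q\<close>-binomial theorem with \<open>a = q\<^bsup>-k\<^esup>\<close> and argument \<open>q\<^bsup>n+1\<^esup>\<close> says that the weights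
  \<open>(q\<^bsup>-k\<^esup>;q)\<^sub>j q\<^sup>j / (q;q)\<^sub>j\<close> turn \<open>q\<^bsup>jn\<^esup>\<close> into \<open>(q;q)\<^sub>n / (q;q)\<^bsub>n-k\<^esub>\<close>, or \<open>0\<close> if \<open>n < k\<close>;
  so the corresponding combination of the values \<open>F(t q\<^sup>j)\<close> is \<open>t\<^sup>k\<close> times the shifted series.
\<close>

section \<open>Mertens' theorem on Cauchy products\<close>

text \<open>The partial sums of the product series are \<Sum> a_i B_(n-i) over i \<le> n, with B the
  bounded, convergent partial sums of \<open>b\<close>; Tannery's theorem gives their limit.
  Absolute convergence on one side suits \<open>Phi\<close>, whose series is only assumed
  summable.\<close>

lemma Cauchy_product_sums_Mertens:
  fixes a b :: "nat \<Rightarrow> 'a::{real_normed_field,banach}"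
  assumes a: "summable (\<lambda>n. norm (a n))" and b: "summable b"
  shows "(\<lambda>n. \<Sum>i\<le>n. a i * b (n - i)) sums (suminf a * suminf b)"
proof -
  define B where "B n = (\<Sum>j\<le>n. b j)" for n
  have B: "B \<longlonglongrightarrow> suminf b"
    unfolding B_def using b by (rule summable_LIMSEQ')
  then obtain C where C: "\<And>n. norm (B n) \<le> C"
    by (metis Bseq_def convergentI convergent_imp_Bseq)
  \<comment> \<open>Padding with 0 turns the sum over i \<le> n into a series over all i, as
    Tannery's theorem requires.\<close>
  define f where "f i n = (if i \<le> n then a i * B (n - i) else 0)" for i n
  have lim: "(\<lambda>n. f i n) \<longlonglongrightarrow> a i * suminf b" for i
  proof -
    have "(\<lambda>n. a i * B (n - i)) \<longlonglongrightarrow> a i * suminf b"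
      by (intro tendsto_mult tendsto_const filterlim_compose[OF B] filterlim_minus_const_nat_at_top)
    moreover have "\<forall>\<^sub>F n in sequentially. a i * B (n - i) = f i n"
      using eventually_ge_at_top[of i] by eventually_elim (simp add: f_def)
    ultimately show ?thesis by (rule Lim_transform_eventually)
  qed
  \<comment> \<open>Nonnegativity lets \<open>norm (a i) * C\<close> dominate the padded zeros
    too.\<close>
  have "C \<ge> 0" using C[of 0] norm_ge_zero order_trans by blast
  then have "norm (f i n) \<le> norm (a i) * C" for i n
    using C by (auto simp: f_def norm_mult intro!: mult_left_mono)
  then have "(\<lambda>n. \<Sum>i. f i n) \<longlonglongrightarrow> (\<Sum>i. a i * suminf b)"
    using tannerys_theorem[of f "\<lambda>i. a i * suminf b" sequentially "\<lambda>i. norm (a i) * C"]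
      lim summable_mult2[OF a, of C] by (simp add: case_prod_unfold)
  moreover have "(\<Sum>i. a i * suminf b) = suminf a * suminf b"
    using a suminf_mult2 summable_norm_cancel by metis
  moreover have "(\<Sum>i. f i n) = (\<Sum>m\<le>n. \<Sum>i\<le>m. a i * b (m - i))" for n
  proof -
    have "(\<Sum>i. f i n) = (\<Sum>i\<le>n. a i * B (n - i))"
      by (subst suminf_finite[of "{..n}"]) (auto simp: f_def)
    also have "\<dots> = (\<Sum>(i,j)\<in>{(i,j). i + j \<le> n}. a i * b j)"
      by (simp add: B_def sum_distrib_left pairs_le_eq_Sigma sum.Sigma)
    also have "\<dots> = (\<Sum>m\<le>n. \<Sum>i\<le>m. a i * b (m - i))"
      by (rule sum.triangle_reindex_eq)
    finally show ?thesis .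
  qed
  ultimately show ?thesis
    by (simp add: sums_def_le)
qed

section \<open>Finite and infinite q-shifted factorials\<close>

lemma qpoch_Suc: "qpoch a q (Suc n) = qpoch a q n * (1 - a * q ^ n)"
  by (simp add: qpoch_def)

lemma qpoch_add: "qpoch a q (m + n) = qpoch a q m * qpoch (a * q ^ m) q n"
  by (induction n) (simp_all add: qpoch_def power_add mult_ac)

lemma mult_power_neq_1:
  fixes a q :: complex
  assumes "norm q < 1" "norm a < 1"
  shows "a * q ^ i \<noteq> 1"
proof -
  have "norm (a * q ^ i) \<le> norm a * 1"
    using assms(1) unfolding norm_mult norm_power
    by (intro mult_left_mono power_le_one) auto
  then show ?thesis using assms(2) by auto
qed

lemma qpoch_nonzero:
  assumes "norm q < 1" "norm a < 1"
  shows "qpoch a q n \<noteq> 0"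
  using mult_power_neq_1[OF assms] by (auto simp: qpoch_def)

lemma convergent_prod_qpoch:
  fixes a q :: complex
  assumes "norm q < 1"
  shows "convergent_prod (\<lambda>i. 1 - a * q ^ i)"
proof -
  have "summable (\<lambda>i. norm (1 - a * q ^ i - 1))"
    using assms by (simp add: norm_mult norm_power summable_mult summable_geometric)
  then show ?thesis
    by (intro abs_convergent_prod_imp_convergent_prod summable_imp_abs_convergent_prod)
qed

lemma qpoch_LIMSEQ:
  assumes "norm q < 1"
  shows "(\<lambda>n. qpoch a q n) \<longlonglongrightarrow> qpoch_inf a q"
  using convergent_prod_LIMSEQ[OF convergent_prod_qpoch[OF assms, of a]]
  by (simp add: qpoch_def qpoch_inf_def LIMSEQ_lessThan_iff_atMost)

lemma qpoch_inf_nonzero: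
  assumes "norm q < 1" "norm a < 1"
  shows "qpoch_inf a q \<noteq> 0"
  unfolding qpoch_inf_def
  using mult_power_neq_1[OF assms] convergent_prod_qpoch[OF assms(1)]
  by (intro prodinf_nonzero) auto

text \<open>This reduces quotients of infinite products whose arguments differ by a power of
  \<open>q\<close> to finite products.\<close>

lemma qpoch_inf_split:
  assumes "norm q < 1"
  shows "qpoch_inf a q = qpoch a q n * qpoch_inf (a * q ^ n) q"
proof (rule LIMSEQ_unique)
  show "(\<lambda>m. qpoch a q (n + m)) \<longlonglongrightarrow> qpoch_inf a q"
    using LIMSEQ_ignore_initial_segment[OF qpoch_LIMSEQ[OF assms], of a n] by (simp add: add.commute)
  show "(\<lambda>m. qpoch a q (n + m)) \<longlonglongrightarrow> qpoch a q n * qpoch_inf (a * q ^ n) q"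
    unfolding qpoch_add by (intro tendsto_mult tendsto_const qpoch_LIMSEQ assms)
qed

section \<open>Cauchy polynomials and the q-binomial theorem\<close>

lemma cauchy_poly_scale: "cauchy_poly q n (x * t) (y * t) = cauchy_poly q n x y * t ^ n"
  by (induction n) (simp_all add: cauchy_poly_def algebra_simps)

text \<open>Links the homogeneous form of the q-binomial theorem used here to the classical
  one.\<close>

lemma cauchy_poly_mult_eq_qpoch: "cauchy_poly q n w (a * w) = qpoch a q n * w ^ n"
  by (induction n) (simp_all add: cauchy_poly_def qpoch_def algebra_simps)

text \<open>Ratio test: the quotient \<open>r n\<close> of consecutive terms tends to
  \<open>u\<close> because q^n tends to 0.\<close>

lemma summable_norm_q_binomial:
  assumes q: "norm q < 1" and u: "norm u < 1"
  shows "summable (\<lambda>n. norm (cauchy_poly q n u v / qpoch q q n))"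
proof -
  define r where "r n = (u - q ^ n * v) / (1 - q * q ^ n)" for n
  have q0: "(\<lambda>n. q ^ n) \<longlonglongrightarrow> 0" using q by (rule LIMSEQ_power_zero)
  have "(\<lambda>n. norm (r n)) \<longlonglongrightarrow> norm ((u - 0 * v) / (1 - q * 0))"
    unfolding r_def by (intro tendsto_intros q0) auto
  then have lim: "(\<lambda>n. norm (r n)) \<longlonglongrightarrow> norm u" by simp
  obtain c where c: "norm u < c" "c < 1" using u dense by blast
  then obtain N where N: "\<And>n. n \<ge> N \<Longrightarrow> norm (r n) < c"
    using order_tendstoD(2)[OF lim c(1)] by (auto simp: eventually_sequentially)
  show ?thesis
  proof (rule summable_ratio_test[OF c(2)])
    fix n assume "n \<ge> N"
    have "cauchy_poly q (Suc n) u v / qpoch q q (Suc n) = r n * (cauchy_poly q n u v / qpoch q q n)"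
      by (simp add: r_def cauchy_poly_def qpoch_def mult_ac)
    then show "norm (norm (cauchy_poly q (Suc n) u v / qpoch q q (Suc n)))
        \<le> c * norm (norm (cauchy_poly q n u v / qpoch q q n))"
      using N[OF \<open>n \<ge> N\<close>] by (simp add: norm_mult[of "r n"] mult_right_mono del: times_divide_eq_right)
  qed
qed

text \<open>
  The power series \<open>f(s) = \<Sum> c\<^sub>n s\<^sup>n\<close> satisfies \<open>(1 - us) f(s) = (1 - vs) f(qs)\<close>; iterating this
  from \<open>s = 1\<close> moves the argument to \<open>0\<close>.
\<close>
theorem q_binomial:
  assumes q: "norm q < 1" and u: "norm u < 1"
  shows "(\<lambda>n. cauchy_poly q n u v / qpoch q q n) sums (qpoch_inf v q / qpoch_inf u q)"
proof -
  define c where "c n = cauchy_poly q n u v / qpoch q q n" for n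
  define f where "f s = (\<Sum>n. c n * s ^ n)" for s
  have c0: "c 0 = 1" by (simp add: c_def cauchy_poly_def qpoch_def)
  have c_Suc: "c (Suc n) * (1 - q ^ Suc n) = c n * (u - q ^ n * v)" for n
    using mult_power_neq_1[OF q q, of n] by (simp add: c_def cauchy_poly_def qpoch_def)
  have abs: "summable (\<lambda>n. norm (c n))"
    unfolding c_def by (rule summable_norm_q_binomial[OF q u])
  have f_sums: "(\<lambda>n. c n * s ^ n) sums f s" if "norm s \<le> 1" for s
    unfolding f_def
  proof (intro summable_sums summable_comparison_test'[OF abs])
    show "norm (c n * s ^ n) \<le> norm (c n)" for n
      using that by (simp add: norm_mult norm_power mult_left_le power_le_one)
  qed
  have f_rec: "(1 - u * s) * f s = (1 - v * s) * f (q * s)" if s: "norm s \<le> 1" for s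
  proof -
    have qs: "norm (q * s) \<le> 1"
      using q s by (simp add: norm_mult mult_le_one)
    have "(\<lambda>n. c n * s ^ n - c n * (q * s) ^ n) sums (f s - f (q * s))"
      by (intro sums_diff f_sums s qs)
    \<comment> \<open>The terms for n = 0 cancel, so the series may start at index 1, where
      \<open>c_Suc\<close> applies.\<close>
    then have "(\<lambda>n. c (Suc n) * s ^ Suc n - c (Suc n) * (q * s) ^ Suc n) sums (f s - f (q * s))"
      by (subst sums_Suc_iff) simp
    moreover have "c (Suc n) * s ^ Suc n - c (Suc n) * (q * s) ^ Suc n
        = u * s * (c n * s ^ n) - v * s * (c n * (q * s) ^ n)" for n
    proof -
      have "c (Suc n) * s ^ Suc n - c (Suc n) * (q * s) ^ Suc n
          = (c (Suc n) * (1 - q ^ Suc n)) * s ^ Suc n"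
        by (simp add: power_mult_distrib algebra_simps)
      then show ?thesis
        unfolding c_Suc by (simp add: power_mult_distrib algebra_simps)
    qed
    ultimately have "(\<lambda>n. u * s * (c n * s ^ n) - v * s * (c n * (q * s) ^ n)) sums (f s - f (q * s))"
      by simp
    moreover have "(\<lambda>n. u * s * (c n * s ^ n) - v * s * (c n * (q * s) ^ n))
        sums (u * s * f s - v * s * f (q * s))"
      by (intro sums_diff sums_mult f_sums s qs)
    ultimately have "f s - f (q * s) = u * s * f s - v * s * f (q * s)"
      by (rule sums_unique2)
    then show ?thesis by (simp add: algebra_simps)
  qed
  have iter: "qpoch u q n * f 1 = qpoch v q n * f (q ^ n)" for n
  proof (induction n)
    case 0
    then show ?case by (simp add: qpoch_def)
  next
    case (Suc n)
    have "norm (q ^ n) \<le> 1" using q by (simp add: norm_power power_le_one)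
    from f_rec[OF this] show ?case
      using Suc.IH by (simp add: qpoch_Suc) (metis mult.assoc mult.left_commute)
  qed
  \<comment> \<open>Summability at s = 1 puts 0 strictly inside the disc of convergence.\<close>
  have "isCont f 0"
    unfolding f_def using isCont_powser[of c 1 0] summable_norm_cancel[OF abs] by simp
  then have "(\<lambda>n. f (q ^ n)) \<longlonglongrightarrow> f 0"
    using LIMSEQ_power_zero[OF q] by (rule isCont_tendsto_compose)
  moreover have "f 0 = 1" using powser_zero[of c] by (simp add: f_def c0)
  ultimately have "(\<lambda>n. qpoch v q n * f (q ^ n)) \<longlonglongrightarrow> qpoch_inf v q * 1"
    by (intro tendsto_mult qpoch_LIMSEQ q) simp
  moreover have "(\<lambda>n. qpoch v q n * f (q ^ n)) \<longlonglongrightarrow> qpoch_inf u q * f 1"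
    unfolding iter[symmetric] by (intro tendsto_mult qpoch_LIMSEQ q tendsto_const)
  ultimately have "qpoch_inf u q * f 1 = qpoch_inf v q"
    using LIMSEQ_unique by force
  then have "f 1 = qpoch_inf v q / qpoch_inf u q"
    using qpoch_inf_nonzero[OF q u] by (simp add: field_simps)
  then show ?thesis
    using f_sums[of 1] by (simp add: c_def)
qed

section \<open>The terminating case and the weights that extract the shift\<close>

lemma q_powi_neg_mult_power:
  fixes q :: complex
  assumes "q \<noteq> 0"
  shows "q powi (- int k) * q ^ k = 1"
  using assms by (simp add: power_int_minus)

text \<open>Since \<open>?A * q ^ k = 1\<close>, the factor with index k kills all terms beyond j =
  k, and splitting k factors off the infinite product at \<open>?A * w\<close> leaves the one at
  \<open>w\<close>, which cancels.\<close>

lemma terminating_q_binomial: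
  assumes q0: "q \<noteq> 0" and q: "norm q < 1" and w: "norm w < 1"
  shows "(\<Sum>j\<le>k. qpoch (q powi (- int k)) q j / qpoch q q j * w ^ j)
    = qpoch (q powi (- int k) * w) q k"
proof -
  let ?A = "q powi (- int k)"
  have vanish: "qpoch ?A q j = 0" if "j > k" for j
    using that q_powi_neg_mult_power[OF q0, of k] by (auto simp: qpoch_def)
  have "(\<lambda>j. qpoch ?A q j / qpoch q q j * w ^ j) sums (qpoch_inf (?A * w) q / qpoch_inf w q)"
    using q_binomial[OF q w, of "?A * w"] by (simp add: cauchy_poly_mult_eq_qpoch)
  moreover have "(\<lambda>j. qpoch ?A q j / qpoch q q j * w ^ j) sums
      (\<Sum>j\<le>k. qpoch ?A q j / qpoch q q j * w ^ j)"
    by (rule sums_finite) (auto simp: vanish)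
  ultimately have "(\<Sum>j\<le>k. qpoch ?A q j / qpoch q q j * w ^ j)
      = qpoch_inf (?A * w) q / qpoch_inf w q"
    using sums_unique2 by blast
  also have "qpoch_inf (?A * w) q = qpoch (?A * w) q k * qpoch_inf (?A * q ^ k * w) q"
    using qpoch_inf_split[OF q, of "?A * w" k] by (simp only: mult_ac)
  also have "?A * q ^ k * w = w"
    using q_powi_neg_mult_power[OF q0, of k] by simp
  finally show ?thesis
    using qpoch_inf_nonzero[OF q w] by simp
qed

lemma sum_qpoch_neg_power:
  assumes q0: "q \<noteq> 0" and q: "norm q < 1"
  shows "(\<Sum>j\<le>k. qpoch (q powi (- int k)) q j / qpoch q q j * q ^ j * (q ^ j) ^ n)
    = (if n < k then 0 else qpoch q q n / qpoch q q (n - k))"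
proof -
  let ?A = "q powi (- int k)"
  \<comment> \<open>The factor q^j in the weights makes the argument q^(n+1) instead of q^n, hence
    inside the unit disc even for n = 0.\<close>
  have "norm (q ^ Suc n) < 1"
    unfolding norm_power using q q0 by (intro power_Suc_less_one) auto
  note terminating_q_binomial[OF q0 q this, of k]
  moreover have "q ^ j * (q ^ j) ^ n = (q ^ Suc n) ^ j" for j
    by (simp add: power_mult_distrib power_mult[symmetric] mult.commute)
  ultimately have eq: "(\<Sum>j\<le>k. qpoch ?A q j / qpoch q q j * q ^ j * (q ^ j) ^ n)
      = qpoch (?A * q ^ Suc n) q k"
    by (simp add: mult.assoc)
  show ?thesis
  proof (cases "n < k")
    case True
    \<comment> \<open>The factor with index i = k - n - 1 of the product vanishes.\<close>
    then obtain i where i: "k = Suc n + i" using less_iff_Suc_add by auto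
    have "?A * q ^ Suc n * q ^ i = 1"
      using q_powi_neg_mult_power[OF q0, of k] unfolding i by (simp add: power_add mult_ac)
    then have "qpoch (?A * q ^ Suc n) q k = 0"
      unfolding qpoch_def using i by (intro prod_zero bexI[of _ i]) auto
    then show ?thesis using eq True by simp
  next
    case False
    \<comment> \<open>Here the product starts at q^(m+1), so it is the tail of (q;q)_n after its
      first m = n - k factors.\<close>
    then obtain m where m: "n = m + k" by (metis le_iff_add linorder_not_less add.commute)
    have "?A * q ^ Suc n = (?A * q ^ k) * (q * q ^ m)"
      unfolding m by (simp add: power_add mult_ac)
    then have "?A * q ^ Suc n = q * q ^ m"
      unfolding q_powi_neg_mult_power[OF q0] by simp
    note eq[unfolded this]
    then show ?thesis
      using False qpoch_nonzero[OF q q, of m] by (simp add: m qpoch_add)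
  qed
qed

section \<open>The unshifted generating function\<close>

text \<open>The \<open>G\<^sub>n\<close> of the overview, isolated because the multiplier in the
  theorem cancels the prefactor of \<open>Psi\<close>.\<close>

definition Psi_core :: "complex list \<Rightarrow> complex list \<Rightarrow> complex \<Rightarrow> nat \<Rightarrow>
    complex \<Rightarrow> complex \<Rightarrow> complex \<Rightarrow> complex" where
  "Psi_core a b q n x y z =
     (\<Sum>k\<le>n. qbinomial q n k * hyp_factor (length a) (length b) q k * W a b q k *
        cauchy_poly q (n - k) y x * z ^ k)"

lemma Psi_mult_eq_core:
  assumes "q \<noteq> 0"
  shows "Psi a b q n x y z * (-1) ^ n * q ^ (n choose 2) = Psi_core a b q n x y z"
proof -
  have "Psi a b q n x y z * (-1) ^ n * q ^ (n choose 2) =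
      ((-1) ^ n * (-1) ^ n) * (q powi (- int (n choose 2)) * q ^ (n choose 2)) * Psi_core a b q n x y z"
    by (simp only: Psi_def Psi_core_def mult_ac)
  then show ?thesis
    using assms by (simp add: q_powi_neg_mult_power flip: power_mult_distrib)
qed

lemma Psi_core_generating_function:
  assumes q: "norm q < 1" and yt: "norm (y * t) < 1"
    and Phi: "summable (Phi_term a b q (z * t))"
  shows "(\<lambda>n. Psi_core a b q n x y z * (t ^ n / qpoch q q n)) sums
    (qpoch_inf (x * t) q / qpoch_inf (y * t) q * Phi a b q (z * t))"
proof -
  define c where "c n = cauchy_poly q n (y * t) (x * t) / qpoch q q n" for n
  have "(\<lambda>n. \<Sum>i\<le>n. c i * Phi_term a b q (z * t) (n - i)) sums
      (suminf c * suminf (Phi_term a b q (z * t)))"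
    unfolding c_def
    by (intro Cauchy_product_sums_Mertens summable_norm_q_binomial q yt Phi)
  moreover have "suminf c = qpoch_inf (x * t) q / qpoch_inf (y * t) q"
    unfolding c_def using sums_unique[OF q_binomial[OF q yt]] by simp
  moreover have "(\<Sum>i\<le>n. c i * Phi_term a b q (z * t) (n - i))
      = Psi_core a b q n x y z * (t ^ n / qpoch q q n)" for n
  proof -
    \<comment> \<open>Mertens puts the absolutely convergent series \<open>c\<close> first;
      reversing the sum restores the index order of \<open>Psi_core\<close>.\<close>
    have "(\<Sum>i\<le>n. c i * Phi_term a b q (z * t) (n - i))
        = (\<Sum>m\<le>n. c (n - m) * Phi_term a b q (z * t) m)"
      by (rule sum.reindex_bij_witness[of _ "\<lambda>m. n - m" "\<lambda>m. n - m"]) auto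
    also have "\<dots> = Psi_core a b q n x y z * (t ^ n / qpoch q q n)"
      unfolding Psi_core_def sum_distrib_right
    proof (rule sum.cong[OF refl])
      fix m assume "m \<in> {..n}"
      then have "t ^ n = t ^ (n - m) * t ^ m" by (simp flip: power_add)
      then show "c (n - m) * Phi_term a b q (z * t) m
          = qbinomial q n m * hyp_factor (length a) (length b) q m * W a b q m *
            cauchy_poly q (n - m) y x * z ^ m * (t ^ n / qpoch q q n)"
        using qpoch_nonzero[OF q q]
        by (simp add: c_def Phi_term_def qbinomial_def cauchy_poly_scale power_mult_distrib) (simp add: mult_ac)
    qed
    finally show ?thesis .
  qed
  ultimately show ?thesis by (simp add: Phi_def)
qed

section \<open>The shifted generating function\<close>

text \<open>Using \<open>sums\<close> makes convergence of the left side part of the claim. The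
  condition on \<open>t ^ k\<close> still admits t = 0 when k = 0.\<close>

theorem theorem1:
  fixes q x y z t :: complex and a b :: "complex list" and k :: nat
  assumes "0 < norm q" and "norm q < 1"
    and "max (norm (y * t)) (norm (z * t)) < 1"
    and "\<And>n. qpochs b q n \<noteq> 0"
    and "t ^ k \<noteq> 0"
    and "\<And>j. j \<le> k \<Longrightarrow> qpoch (x * t) q j \<noteq> 0"
    and "\<And>j. j \<le> k \<Longrightarrow> summable (Phi_term a b q (z * t * q ^ j))"
  shows "(\<lambda>n. Psi a b q (n + k) x y z * (-1) ^ (n + k) * q ^ ((n + k) choose 2) *
            (t ^ n / qpoch q q n))
         sums
         (qpoch_inf (x * t) q / (t ^ k * qpoch_inf (y * t) q) *
           (\<Sum>j\<le>k. qpochs [q powi (- int k), y * t] q j * q ^ j / qpochs [q, x * t] q j *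
              Phi a b q (z * t * q ^ j)))"
proof -
  have q0: "q \<noteq> 0" and q: "norm q < 1" and yt: "norm (y * t) < 1"
    using assms(1-3) by auto
  define A where "A = q powi (- int k)"
  define d where "d j = qpoch A q j / qpoch q q j * q ^ j" for j
  define R where "R j = qpoch_inf (x * t) q / qpoch_inf (y * t) q
    * (qpochs [A, y * t] q j * q ^ j / qpochs [q, x * t] q j * Phi a b q (z * t * q ^ j))" for j
  define G where "G n = Psi_core a b q n x y z" for n
  have "(\<lambda>n. d j * (G n * ((t * q ^ j) ^ n / qpoch q q n))) sums R j" if "j \<le> k" for j
  proof -
    have "norm (y * t * q ^ j) \<le> norm (y * t) * 1"
      unfolding norm_mult[of "y * t"] norm_power
      using q by (intro mult_left_mono power_le_one) auto
    then have ytj: "norm (y * (t * q ^ j)) < 1" using yt by (simp add: mult.assoc)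
    have "(\<lambda>n. d j * (G n * ((t * q ^ j) ^ n / qpoch q q n))) sums
       (d j * (qpoch_inf (x * (t * q ^ j)) q / qpoch_inf (y * (t * q ^ j)) q
         * Phi a b q (z * (t * q ^ j))))"
      unfolding G_def
      using assms(7)[OF that] by (intro sums_mult Psi_core_generating_function q ytj) (simp add: mult.assoc)
    \<comment> \<open>Splitting off j factors at \<open>x * t\<close> and \<open>y * t\<close>
      produces the quotient (yt;q)_j / (xt;q)_j of the claimed sum.\<close>
    also have "d j * (qpoch_inf (x * (t * q ^ j)) q / qpoch_inf (y * (t * q ^ j)) q
         * Phi a b q (z * (t * q ^ j))) = R j"
      using qpoch_inf_split[OF q, of "x * t" j] qpoch_inf_split[OF q, of "y * t" j]
        assms(6)[OF that] qpoch_nonzero[OF q yt, of j]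
      by (simp add: d_def R_def qpochs_def mult_ac)
    finally show ?thesis .
  qed
  then have "(\<lambda>n. \<Sum>j\<le>k. d j * (G n * ((t * q ^ j) ^ n / qpoch q q n))) sums (\<Sum>j\<le>k. R j)"
    by (intro sums_sum) auto
  moreover have "(\<Sum>j\<le>k. d j * (G n * ((t * q ^ j) ^ n / qpoch q q n)))
      = (if n < k then 0 else G n * t ^ n / qpoch q q (n - k))" for n
  proof -
    have "(\<Sum>j\<le>k. d j * (G n * ((t * q ^ j) ^ n / qpoch q q n)))
        = G n * t ^ n / qpoch q q n * (\<Sum>j\<le>k. d j * (q ^ j) ^ n)"
      by (simp add: sum_distrib_left power_mult_distrib mult_ac)
    also have "(\<Sum>j\<le>k. d j * (q ^ j) ^ n) = (if n < k then 0 else qpoch q q n / qpoch q q (n - k))"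
      unfolding d_def A_def by (rule sum_qpoch_neg_power[OF q0 q])
    finally show ?thesis
      using qpoch_nonzero[OF q q, of n] by simp
  qed
  ultimately have "(\<lambda>n. if n < k then 0 else G n * t ^ n / qpoch q q (n - k)) sums (\<Sum>j\<le>k. R j)"
    by simp
  \<comment> \<open>The first k terms are 0, so reindexing by k leaves the value unchanged.\<close>
  then have "(\<lambda>n. G (n + k) * t ^ (n + k) / qpoch q q n) sums (\<Sum>j\<le>k. R j)"
    by (subst (asm) sums_zero_iff_shift[of k, symmetric]) auto
  then have "(\<lambda>n. G (n + k) * t ^ (n + k) / qpoch q q n / t ^ k) sums ((\<Sum>j\<le>k. R j) / t ^ k)"
    by (rule sums_divide)
  \<comment> \<open>For k > 0 the hypothesis on \<open>t ^ k\<close> gives t \<noteq> 0; for k = 0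
    there is no power of t to cancel.\<close>
  moreover have "G (n + k) * t ^ (n + k) / qpoch q q n / t ^ k
      = Psi a b q (n + k) x y z * (-1) ^ (n + k) * q ^ ((n + k) choose 2) * (t ^ n / qpoch q q n)" for n
    using assms(5) unfolding Psi_mult_eq_core[OF q0] G_def by (cases "k = 0") (simp_all add: power_add)
  moreover have "(\<Sum>j\<le>k. R j) / t ^ k = qpoch_inf (x * t) q / (t ^ k * qpoch_inf (y * t) q) *
      (\<Sum>j\<le>k. qpochs [A, y * t] q j * q ^ j / qpochs [q, x * t] q j * Phi a b q (z * t * q ^ j))"
    unfolding R_def sum_distrib_left[symmetric] by simp
  ultimately show ?thesis
    unfolding A_def by simp
qed

end
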